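(* Let $A$ be an invertible Hermitian $n\times n$ complex matrix with eigendecomposition $A=U\Lambda U^\dagger$, where $U$ is unitary and $\Lambda$ is real diagonal. Then the Hessian of the trace norm with respect to the Hermitian argument $A$ is $$\mathcal{H}_{A,A}(\|A\|_1)=\frac12K\left[\left(|A|^{-1}\right)_\oplus-A_\oplus\left(|A|_\oplus\right)^{-1}\left(|A|^{-1}\right)_\oplus\left(|A|_\oplus\right)^{-1}A_\oplus\right],$$ and equivalently $$\mathcal{H}_{A,A}(\|A\|_1)=K\,(U^*\otimes U)\left[I_{n^2}-\mathrm{sign}(\Lambda)\otimes\mathrm{sign}(\Lambda)\right]\left(|\Lambda|_\oplus\right)^{-1}(U^T\otimes U^\dagger).$$
   Context: For a matrix $X$, $X^*$ is the entrywise complex conjugate, $X^\dagger=(X^* )^T$, $|X|=\sqrt{X^\dagger X}$, and $\|X\|_1=\mathrm{Tr}|X|$ is the trace norm. $\mathrm{vec}\,X$ stacks the columns of $X$ into a column vector. For an $n\times n$ matrix $X$, $X_\oplus:=X^T\otimes I_n+I_n\otimes X$ ($\otimes$ is the Kronecker product, $I_m$ the $m\times m$ identity). For real diagonal $\Lambda$, $\mathrm{sign}(\Lambda)$ is the diagonal matrix of the signs of its entries. $K=\sum_{i,j=1}^nJ_n^{ji}\otimes J_n^{ij}$ with $(J_n^{ij})_{kl}=\delta_{ik}\delta_{jl}$ is the commutation matrix, so that $\mathrm{vec}\,X^T=K\,\mathrm{vec}\,X$. Unpatterned derivatives: for a (real-)differentiable scalar or column-vector-valued function $g$ of a complex $n\times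 n$ matrix $X$ with independent entries, $D_Xg$ and $D_{X^*}g$ are the unique matrices such that $dg=(D_Xg)\,d\,\mathrm{vec}X+(D_{X^*}g)\,d\,\mathrm{vec}X^*$ (Wirtinger derivatives; row vectors when $g$ is scalar). Derivatives with respect to a Hermitian argument: for Hermitian $A$, $D_Ag:=[D_Xg+(D_{X^*}g)K]_{X=A}$, for scalar or column-vector-valued $g$. For scalar $g$, the Hessian with respect to the Hermitian argument is $\mathcal{H}_{A,A}(g):=D_A(D_Ag)^T$, meaning that $D_A$ is applied to the column-vector-valued function $X\mapsto[D_Xg+(D_{X^*}g)K]^T$ of the unpatterned matrix $X$. Here $\mathcal{H}_{A,A}(\|A\|_1)$ denotes this Hessian for $g(X)=\|X\|_1$, considered on invertible $X$. *)

theory Defs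
  imports "HOL-Analysis.Analysis"
begin

definition mat_cnj :: "complex^'n^'m \<Rightarrow> complex^'n^'m" where
  "mat_cnj X = (\<chi> i j. cnj (X $ i $ j))"

definition mat_adj :: "complex^'n^'m \<Rightarrow> complex^'m^'n" where
  "mat_adj X = transpose (mat_cnj X)"

definition hermitian_mat :: "complex^'n^'n \<Rightarrow> bool" where
  "hermitian_mat A \<longleftrightarrow> mat_adj A = A"

definition unitary_mat :: "complex^'n^'n \<Rightarrow> bool" where
  "unitary_mat U \<longleftrightarrow> mat_adj U ** U = mat 1 \<and> U ** mat_adj U = mat 1"

definition real_diagonal_mat :: "complex^'n^'n \<Rightarrow> bool" where
  "real_diagonal_mat L \<longleftrightarrow> (\<forall>i j. i \<noteq> j \<longrightarrow> L $ i $ j = 0) \<and> (\<forall>i. L $ i $ i \<in> \<real>)"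

text \<open>On real entries, the complex \<open>sgn\<close> is the usual sign with \<open>sgn 0 = 0\<close>.\<close>

definition sign_mat :: "complex^'n^'n \<Rightarrow> complex^'n^'n" where
  "sign_mat L = (\<chi> i j. if i = j then sgn (L $ i $ i) else 0)"

definition psd_mat :: "complex^'n^'n \<Rightarrow> bool" where
  "psd_mat P \<longleftrightarrow> hermitian_mat P \<and>
     (\<forall>x. 0 \<le> Re (\<Sum>i\<in>UNIV. \<Sum>j\<in>UNIV. cnj (x $ i) * P $ i $ j * x $ j))"

text \<open>The principal square root of a positive semidefinite matrix.\<close>

definition mat_sqrt :: "complex^'n^'n \<Rightarrow> complex^'n^'n" where
  "mat_sqrt P = (THE S. psd_mat S \<and> S ** S = P)"

definition mat_abs :: "complex^'n^'n \<Rightarrow> complex^'n^'n" where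
  "mat_abs X = mat_sqrt (mat_adj X ** X)"

text \<open>The trace of \<open>mat_abs X\<close> is a nonnegative real; it is kept as a complex number
  because Wirtinger derivatives are taken of complex-valued functions.\<close>

definition trace_norm :: "complex^'n^'n \<Rightarrow> complex" where
  "trace_norm X = trace (mat_abs X)"

text \<open>Row and column indices of Kronecker products are pairs in lexicographic order (first
  component is the block index). Hence in the column-stacking vector of \<open>X\<close> the first
  component of the index is the column of \<open>X\<close> and the second one the row.\<close>

definition kron :: "complex^'n^'m \<Rightarrow> complex^'q^'p \<Rightarrow> complex^('n \<times> 'q)^('m \<times> 'p)"
    (infixl "\<otimes>\<^sub>K" 75) where
  "A \<otimes>\<^sub>K B = (\<chi> r c. A $ fst r $ fst c * B $ snd r $ snd c)"

definition vec_cols :: "complex^'n^'m \<Rightarrow> complex^('n \<times> 'm)" where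
  "vec_cols X = (\<chi> p. X $ snd p $ fst p)"

definition kron_sum :: "complex^'n^'n \<Rightarrow> complex^('n \<times> 'n)^('n \<times> 'n)" where
  "kron_sum X = transpose X \<otimes>\<^sub>K mat 1 + mat 1 \<otimes>\<^sub>K X"

definition unit_mat :: "'n::finite \<Rightarrow> 'n \<Rightarrow> complex^'n^'n" where
  "unit_mat i j = (\<chi> k l. if i = k \<and> j = l then 1 else 0)"

definition commutation_mat :: "complex^('n::finite \<times> 'n)^('n \<times> 'n)" where
  "commutation_mat = (\<Sum>i\<in>UNIV. \<Sum>j\<in>UNIV. unit_mat j i \<otimes>\<^sub>K unit_mat i j)"

lemma vec_cols_transpose:
  fixes X :: "complex^'n^'n"
  shows "vec_cols (transpose X) = commutation_mat *v vec_cols X"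
proof -
  have K: "(commutation_mat :: complex^('n \<times> 'n)^('n \<times> 'n)) $ (a, b) $ (c, d)
      = (if c = b then if d = a then 1 else 0 else 0)" for a b c d :: 'n
  proof -
    have "commutation_mat $ (a, b) $ (c, d) = (\<Sum>i\<in>UNIV. \<Sum>j\<in>UNIV.
        if i = b then if j = a then if c = b \<and> d = a then 1 else 0 else 0 else (0::complex))"
      unfolding commutation_mat_def kron_def unit_mat_def sum_component vec_lambda_beta
      by (intro sum.cong) auto
    also have "\<dots> = (\<Sum>i\<in>UNIV. if i = b then if c = b \<and> d = a then 1 else 0 else 0)"
      by (intro sum.cong) auto
    finally show ?thesis by simp
  qed
  show ?thesis
  proof (simp add: vec_eq_iff, intro allI)
    fix a b :: 'n
    have "(commutation_mat *v vec_cols X) $ (a, b)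
        = (\<Sum>c\<in>UNIV. \<Sum>d\<in>UNIV. if c = b then if d = a then X $ a $ b else 0 else 0)"
      by (auto simp: matrix_vector_mult_def K vec_cols_def UNIV_Times_UNIV[symmetric]
            sum.cartesian_product simp del: UNIV_Times_UNIV intro!: sum.cong)
    also have "\<dots> = (\<Sum>c\<in>UNIV. if c = b then X $ a $ b else 0)"
      by (intro sum.cong) auto
    finally show "vec_cols (transpose X) $ (a, b) = (commutation_mat *v vec_cols X) $ (a, b)"
      by (simp add: vec_cols_def transpose_def)
  qed
qed

text \<open>The derivative is the Frechet derivative over the reals.\<close>

definition has_wirtinger_derivs ::
  "(complex^'n^'n \<Rightarrow> complex^'m) \<Rightarrow> complex^('n \<times> 'n)^'m \<Rightarrow> complex^('n \<times> 'n)^'m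
    \<Rightarrow> complex^'n^'n \<Rightarrow> bool" where
  "has_wirtinger_derivs g D E X \<longleftrightarrow>
     (g has_derivative (\<lambda>H. D *v vec_cols H + E *v vec_cols (mat_cnj H))) (at X)"

lemma has_wirtinger_derivs_unique:
  fixes g :: "complex^'n^'n \<Rightarrow> complex^'m"
  assumes "has_wirtinger_derivs g D E X" "has_wirtinger_derivs g D' E' X"
  shows "D = D' \<and> E = E'"
proof -
  have "(\<lambda>H. D *v vec_cols H + E *v vec_cols (mat_cnj H))
      = (\<lambda>H. D' *v vec_cols H + E' *v vec_cols (mat_cnj H))"
    using assms unfolding has_wirtinger_derivs_def by (rule has_derivative_unique)
  hence eq: "D *v vec_cols H + E *v vec_cols (mat_cnj H)
      = D' *v vec_cols H + E' *v vec_cols (mat_cnj H)" for H by metis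
  have rot: "D *v vec_cols H - E *v vec_cols (mat_cnj H)
      = D' *v vec_cols H - E' *v vec_cols (mat_cnj H)" for H
  proof -
    let ?H = "\<chi> i j. \<i> * H $ i $ j"
    have 1: "M *v vec_cols ?H = \<i> *s (M *v vec_cols H)" for M :: "complex^('n \<times> 'n)^'m"
      by (simp add: vec_eq_iff matrix_vector_mult_def vec_cols_def sum_distrib_left ac_simps)
    have 2: "M *v vec_cols (mat_cnj ?H) = - (\<i> *s (M *v vec_cols (mat_cnj H)))"
      for M :: "complex^('n \<times> 'n)^'m"
      by (simp add: vec_eq_iff matrix_vector_mult_def vec_cols_def mat_cnj_def
            sum_distrib_left ac_simps flip: sum_negf)
    have "\<i> *s (D *v vec_cols H - E *v vec_cols (mat_cnj H))
        = \<i> *s (D' *v vec_cols H - E' *v vec_cols (mat_cnj H))"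
      using eq[of ?H] unfolding 1 2 by (simp add: vec_eq_iff algebra_simps)
    thus ?thesis by (simp add: vec_eq_iff flip: right_diff_distrib)
  qed
  have lin: "a = c \<and> b = d" if "a + b = c + d" "a - b = c - d" for a b c d :: "complex^'m"
  proof -
    have "2 * a $ i = (a + b) $ i + (a - b) $ i" "2 * b $ i = (a + b) $ i - (a - b) $ i"
      "2 * c $ i = (c + d) $ i + (c - d) $ i" "2 * d $ i = (c + d) $ i - (c - d) $ i" for i
      by simp_all
    hence "2 * a $ i = 2 * c $ i" "2 * b $ i = 2 * d $ i" for i
      unfolding that by metis+
    thus ?thesis by (simp add: vec_eq_iff)
  qed
  have "D *v vec_cols H = D' *v vec_cols H"
    and "E *v vec_cols (mat_cnj H) = E' *v vec_cols (mat_cnj H)" for H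
    using lin[OF eq[of H] rot[of H]] by blast+
  moreover have "\<exists>H. vec_cols H = v" and "\<exists>H. vec_cols (mat_cnj H) = v"
    for v :: "complex^('n \<times> 'n)"
  proof -
    show "\<exists>H. vec_cols H = v"
      by (rule exI[of _ "\<chi> i j. v $ (j, i)"]) (simp add: vec_cols_def vec_eq_iff)
    show "\<exists>H. vec_cols (mat_cnj H) = v"
      by (rule exI[of _ "\<chi> i j. cnj (v $ (j, i))"])
        (simp add: vec_cols_def mat_cnj_def vec_eq_iff)
  qed
  ultimately have "D *v v = D' *v v" "E *v v = E' *v v" for v by metis+
  thus ?thesis by (simp add: matrix_eq)
qed

definition deriv_X :: "(complex^'n^'n \<Rightarrow> complex^'m) \<Rightarrow> complex^'n^'n \<Rightarrow> complex^('n \<times> 'n)^'m" where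
  "deriv_X g X = (THE D. \<exists>E. has_wirtinger_derivs g D E X)"

definition deriv_Xcnj :: "(complex^'n^'n \<Rightarrow> complex^'m) \<Rightarrow> complex^'n^'n \<Rightarrow> complex^('n \<times> 'n)^'m" where
  "deriv_Xcnj g X = (THE E. \<exists>D. has_wirtinger_derivs g D E X)"

text \<open>Defined for every \<open>X\<close>, since the Hessian differentiates it with respect to an
  unpatterned matrix.\<close>

definition deriv_herm :: "(complex^'n^'n \<Rightarrow> complex^'m) \<Rightarrow> complex^'n^'n \<Rightarrow> complex^('n \<times> 'n)^'m" where
  "deriv_herm g X = deriv_X g X + deriv_Xcnj g X ** commutation_mat"

text \<open>A scalar function is a \<open>complex^1\<close>-valued one, so its derivative is a matrix with one
  row; the transpose of that row is read as a column vector.\<close>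

definition grad_herm :: "(complex^'n^'n \<Rightarrow> complex) \<Rightarrow> complex^'n^'n \<Rightarrow> complex^('n \<times> 'n)" where
  "grad_herm g X = column 1 (transpose (deriv_herm (\<lambda>Y. vec (g Y) :: complex^1) X))"

definition hessian_herm ::
  "(complex^'n^'n \<Rightarrow> complex) \<Rightarrow> complex^'n^'n \<Rightarrow> complex^('n \<times> 'n)^('n \<times> 'n)" where
  "hessian_herm g A = deriv_herm (grad_herm g) A"

end

theory Submission imports Defs begin

text \<open>
  Write \<open>X = W S\<close> with \<open>W\<close> unitary and \<open>S = |X|\<close>. Existence of this polar decomposition follows
  without spectral theory: if \<open>W\<close> maximises \<open>Re tr (V\<dagger> X)\<close> over the compact unitary group, then
  \<open>W\<dagger> X\<close> is positive semidefinite.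

  If \<open>Y = V T\<close> is another polar decomposition, \<open>Z = W\<dagger> V\<close> and \<open>E = W\<dagger> (Y - X)\<close>, then
  \<open>S (Z - 1) + (Z - 1) T = E - E\<dagger> Z\<close> holds exactly. The Sylvester operator on the left is coercive,
  so \<open>V - W = W (Z - 1)\<close> is Lipschitz in \<open>Y - X\<close>, and a second use of the identity gives the
  derivative \<open>dW = W D\<close>, where \<open>S D + D S = W\<dagger> dX - dX\<dagger> W\<close>.

  As \<open>tr |X| = tr (W\<dagger> X)\<close>, the trace norm has derivative \<open>Re tr (W\<dagger> dX)\<close>, so its gradient is
  \<open>K vec (W + W\<dagger>) / 2\<close>. At a Hermitian point \<open>Q = dW + dW\<dagger>\<close> satisfies
  \<open>S Q + Q S = P - W P W\<close> with \<open>P = dX + dX\<dagger>\<close>, which makes the Hessian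
  \<open>K (S\<^sub>\<oplus>)\<^sup>-\<^sup>1 (1 - W\<^sup>T \<otimes> W)\<close>. In the eigenbasis of \<open>A\<close> all matrices are diagonal and both
  formulas reduce to scalar identities.
\<close>

section \<open>Matrices as a Euclidean space\<close>

lemma inner_complex_mult_left: "inner (a * b) c = inner b (cnj a * (c::complex))"
  by (simp add: inner_complex_def algebra_simps)

text \<open>Supplies, through the interpretation that follows, continuity, the product rule and a
  norm bound up to a constant for matrix products.\<close>

lemma bounded_bilinear_matrix_mult:
  "bounded_bilinear ((**) :: complex^'n^'m \<Rightarrow> complex^'p^'n \<Rightarrow> complex^'p^'m)"
  unfolding bilinear_conv_bounded_bilinear[symmetric] bilinear_def
  by (auto intro!: linearI simp: vec_eq_iff matrix_matrix_mult_def sum.distrib algebra_simps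
      scaleR_sum_right)

interpretation mm: bounded_bilinear "(**) :: complex^'n^'m \<Rightarrow> complex^'p^'n \<Rightarrow> complex^'p^'m"
  by (rule bounded_bilinear_matrix_mult)

lemma mat_adj_nth [simp]: "mat_adj A $ i $ j = cnj (A $ j $ i)"
  by (simp add: mat_adj_def mat_cnj_def transpose_def)

lemma mat_adj_mat_adj [simp]: "mat_adj (mat_adj A) = A"
  by (simp add: vec_eq_iff)

lemma mat_adj_mult: "mat_adj (A ** B) = mat_adj B ** mat_adj A"
  by (simp add: vec_eq_iff matrix_matrix_mult_def mult.commute)

lemma mat_adj_mat_1 [simp]: "mat_adj (mat 1) = mat 1"
  by (auto simp: vec_eq_iff mat_def)

lemma bounded_linear_mat_adj: "bounded_linear (mat_adj :: complex^'n^'m \<Rightarrow> complex^'m^'n)"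
  unfolding linear_conv_bounded_linear[symmetric]
  by (rule linearI) (simp_all add: vec_eq_iff)

lemma mat_adj_add: "mat_adj (A + B) = mat_adj A + mat_adj B"
  and mat_adj_diff: "mat_adj (A - B) = mat_adj A - mat_adj B"
  by (simp_all add: vec_eq_iff)

lemma inner_mat_adj: "inner (mat_adj A) (mat_adj B) = inner A B"
proof -
  have "inner (mat_adj A) (mat_adj B) = (\<Sum>i\<in>UNIV. \<Sum>j\<in>UNIV. inner (A $ j $ i) (B $ j $ i))"
    by (simp add: inner_vec_def inner_complex_def)
  also have "\<dots> = inner A B"
    unfolding inner_vec_def by (rule sum.swap)
  finally show ?thesis .
qed

lemma norm_mat_adj [simp]: "norm (mat_adj A) = norm A"
  by (simp add: norm_eq_sqrt_inner inner_mat_adj)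

lemma inner_matrix_vector_mult: "inner (A *v x) y = inner x (mat_adj A *v (y :: complex^'m))"
proof -
  have "inner (A *v x) y = (\<Sum>i\<in>UNIV. \<Sum>j\<in>UNIV. inner (A $ i $ j * x $ j) (y $ i))"
    by (simp add: inner_vec_def matrix_vector_mult_def inner_sum_left)
  also have "\<dots> = (\<Sum>j\<in>UNIV. \<Sum>i\<in>UNIV. inner (x $ j) (cnj (A $ i $ j) * y $ i))"
    by (subst sum.swap) (simp add: inner_complex_mult_left)
  also have "\<dots> = inner x (mat_adj A *v y)"
    by (simp add: inner_vec_def matrix_vector_mult_def inner_sum_right)
  finally show ?thesis .
qed

lemma inner_columns: "inner A B = (\<Sum>k\<in>UNIV. inner (column k A) (column k (B :: complex^'n^'m)))"
  unfolding inner_vec_def column_def by (subst sum.swap) simp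

lemma column_matrix_mult: "column k (A ** B) = A *v column k B"
  by (simp add: vec_eq_iff column_def matrix_matrix_mult_def matrix_vector_mult_def)

text \<open>Reduces columnwise to \<open>inner_matrix_vector_mult\<close>. It moves unitary factors
  across the inner product.\<close>

lemma inner_matrix_mult: "inner (A ** B) C = inner B (mat_adj A ** (C :: complex^'n^'m))"
  by (simp add: inner_columns column_matrix_mult inner_matrix_vector_mult)

lemma inner_eq_Re_trace: "inner A B = Re (trace (mat_adj A ** B))"
proof -
  have "inner A B = (\<Sum>i\<in>UNIV. \<Sum>j\<in>UNIV. inner (A $ j $ i) (B $ j $ i))"
    unfolding inner_vec_def by (rule sum.swap)
  thus ?thesis by (simp add: trace_def matrix_matrix_mult_def inner_complex_def)
qed

lemma norm_column: "(norm A)\<^sup>2 = (\<Sum>k\<in>UNIV. (norm (column k (A :: complex^'n^'m)))\<^sup>2)"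
  by (simp add: power2_norm_eq_inner inner_columns)

lemma psd_mat_iff_inner:
  "psd_mat S \<longleftrightarrow> hermitian_mat S \<and> (\<forall>x. 0 \<le> inner x (S *v x))"
proof -
  have "Re (\<Sum>i\<in>UNIV. \<Sum>j\<in>UNIV. cnj (x $ i) * S $ i $ j * x $ j) = inner x (S *v x)" for x
    by (simp add: inner_vec_def matrix_vector_mult_def inner_complex_def
        sum_distrib_left algebra_simps sum.distrib sum_subtractf flip: sum_negf)
  thus ?thesis unfolding psd_mat_def by simp
qed

section \<open>Coercivity of the Sylvester operator\<close>

text \<open>Left multiplication acts on each column separately, so the vector bound is summed over
  the columns.\<close>

lemma inner_mult_left_ge:
  assumes "\<And>x. c * (norm x)\<^sup>2 \<le> inner x (S *v x)"
  shows "c * (norm D)\<^sup>2 \<le> inner D (S ** (D :: complex^'n^'m))"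
  unfolding norm_column inner_columns column_matrix_mult sum_distrib_left
  by (rule sum_mono) (rule assms)

text \<open>Taking adjoints turns \<open>D ** T\<close> into a left multiplication, whose
  contribution is nonnegative. Only \<open>S\<close> carries the constant \<open>c\<close>, so
  \<open>T\<close> may be \<open>mat_abs Y\<close> for varying \<open>Y\<close>, without a uniform
  lower bound.\<close>

lemma sylvester_coercive:
  assumes S: "\<And>x. c * (norm x)\<^sup>2 \<le> inner x (S *v x)" and T: "psd_mat T"
  shows "c * (norm D)\<^sup>2 \<le> inner D (S ** D + D ** (T :: complex^'n^'n))"
proof -
  have h: "mat_adj T = T" using T by (simp add: psd_mat_def hermitian_mat_def)
  have "0 * (norm (mat_adj D))\<^sup>2 \<le> inner (mat_adj D) (T ** mat_adj D)"
    by (rule inner_mult_left_ge) (use T in \<open>simp add: psd_mat_iff_inner\<close>)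
  also have "\<dots> = inner (mat_adj D) (mat_adj (D ** T))"
    by (simp add: mat_adj_mult h)
  finally have "0 \<le> inner D (D ** T)" by (simp only: inner_mat_adj mult_zero_left)
  thus ?thesis using inner_mult_left_ge[of c S D, OF S] by (simp add: inner_add_right)
qed

lemma sylvester_norm_le:
  assumes S: "\<And>x. c * (norm x)\<^sup>2 \<le> inner x (S *v x)" and T: "psd_mat T"
  shows "c * norm D \<le> norm (S ** D + D ** (T :: complex^'n^'n))"
proof (cases "D = 0")
  case False
  have "c * (norm D)\<^sup>2 \<le> norm D * norm (S ** D + D ** T)"
    using sylvester_coercive[OF S T] norm_cauchy_schwarz order_trans by blast
  thus ?thesis using False by (simp add: power2_eq_square mult.left_commute)
qed simp

text \<open>Eigenvalues are avoided. Let \<open>K\<close> bound \<open>S\<close> from above and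
  \<open>m\<close> bound it from below by injectivity. Positivity tested at x - y / K with
  \<open>y = S *v x\<close> gives \<open>inner y y / K \<le> inner x (S *v x)\<close>, and
  \<open>norm y\<close> is at least \<open>m * norm x\<close>.\<close>

lemma psd_invertible_coercive:
  assumes "psd_mat S" "invertible S"
  obtains c where "c > 0" "\<And>x. c * (norm x)\<^sup>2 \<le> inner x (S *v x)"
proof -
  have h: "mat_adj S = S" and pos: "0 \<le> inner x (S *v x)" for x
    using assms by (auto simp: psd_mat_iff_inner hermitian_mat_def)
  have "inj ((*v) S)"
    using assms(2) matrix_left_invertible_injective invertible_def by blast
  then obtain m where m: "m > 0" "\<And>x. m * norm x \<le> norm (S *v x)"
    using linear_inj_bounded_below_pos[of "(*v) S"] by (auto simp: mult.commute)
  obtain K where K: "K > 0" "\<And>x. norm (S *v x) \<le> norm x * K"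
    using bounded_linear.pos_bounded[OF matrix_vector_mul_bounded_linear[of S]] by blast
  have "m\<^sup>2 / K * (norm x)\<^sup>2 \<le> inner x (S *v x)" for x
  proof -
    define y where "y = S *v x"
    have "0 \<le> inner (x - (1/K) *\<^sub>R y) (S *v (x - (1/K) *\<^sub>R y))" by (rule pos)
    also have "\<dots> = inner x (S *v x) - (2/K) * inner y y + (1/K)\<^sup>2 * inner y (S *v y)"
    proof -
      have "inner x (S *v y) = inner y y"
        by (metis h inner_matrix_vector_mult y_def)
      moreover have "S *v ((1/K) *\<^sub>R y) = (1/K) *\<^sub>R (S *v y)"
        by (rule linear_cmul) (rule matrix_vector_mul_linear)
      ultimately show ?thesis
        by (simp add: algebra_simps y_def[symmetric] power2_eq_square)
    qed
    also have "inner y (S *v y) \<le> K * inner y y"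
    proof -
      have "inner y (S *v y) \<le> norm y * norm (S *v y)" by (rule norm_cauchy_schwarz)
      also have "\<dots> \<le> norm y * (norm y * K)" by (intro mult_left_mono K) simp
      finally show ?thesis by (simp add: norm_eq_sqrt_inner mult_ac power2_eq_square[symmetric])
    qed
    hence "(1/K)\<^sup>2 * inner y (S *v y) \<le> (1/K) * inner y y"
      using K(1) by (simp add: power2_eq_square field_simps)
    finally have 1: "inner y y / K \<le> inner x (S *v x)" using K(1) by (simp add: field_simps)
    have "(m * norm x)\<^sup>2 \<le> (norm y)\<^sup>2"
      unfolding y_def using m by (intro power_mono) auto
    hence "m\<^sup>2 / K * (norm x)\<^sup>2 \<le> inner y y / K"
      using K(1) by (simp add: power_mult_distrib power2_norm_eq_inner divide_right_mono)
    with 1 show ?thesis by linarith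
  qed
  moreover have "m\<^sup>2 / K > 0" using m K by simp
  ultimately show ?thesis using that by blast
qed

section \<open>Polar decomposition\<close>

lemma norm_unitary_mat:
  assumes "unitary_mat (U :: complex^'n^'n)"
  shows "norm U = sqrt (real CARD('n))"
  using assms by (simp add: norm_eq_sqrt_inner inner_eq_Re_trace unitary_mat_def trace_I)

text \<open>Unitary matrices all have the same norm, and the two defining equations are closed
  conditions.\<close>

lemma compact_unitary_mat: "compact {U :: complex^'n^'n. unitary_mat U}"
  unfolding compact_eq_bounded_closed
proof
  show "bounded {U :: complex^'n^'n. unitary_mat U}"
    by (rule boundedI[of _ "sqrt (real CARD('n))"]) (simp add: norm_unitary_mat)
  have *: "continuous_on UNIV (mat_adj :: complex^'n^'n \<Rightarrow> _)"
    using bounded_linear_mat_adj linear_continuous_on by blast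
  have "closed {U :: complex^'n^'n. mat_adj U ** U = mat 1}"
    "closed {U :: complex^'n^'n. U ** mat_adj U = mat 1}"
    by (intro closed_Collect_eq mm.continuous_on continuous_on_id continuous_on_const *)+
  thus "closed {U :: complex^'n^'n. unitary_mat U}"
    unfolding unitary_mat_def by (rule closed_Collect_conj)
qed

lemma unitary_mat_mult: "unitary_mat U \<Longrightarrow> unitary_mat V \<Longrightarrow> unitary_mat (U ** V)"
  unfolding unitary_mat_def mat_adj_mult
  by (metis matrix_mul_assoc matrix_mul_rid)

section \<open>Sesquilinear forms and rank-one unitaries\<close>

definition sesq :: "complex^'n^'n \<Rightarrow> complex^'n \<Rightarrow> complex^'n \<Rightarrow> complex" where
  "sesq S x y = (\<Sum>i\<in>UNIV. cnj (x $ i) * (S *v y) $ i)"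

lemma sesq_add_left: "sesq S (x + y) z = sesq S x z + sesq S y z"
  and sesq_add_right: "sesq S x (y + z) = sesq S x y + sesq S x z"
  by (simp_all add: sesq_def matrix_vector_right_distrib algebra_simps sum.distrib)

lemma sesq_scale_left: "sesq S (c *s x) z = cnj c * sesq S x z"
  and sesq_scale_right: "sesq S x (c *s z) = c * sesq S x z"
  by (simp_all add: sesq_def vector_scalar_commute sum_distrib_left algebra_simps)

lemma sesq_axis: "sesq S (axis i 1) (axis j 1) = S $ i $ j"
proof -
  have "(S *v axis j 1) $ k = S $ k $ j" for k
    by (simp add: matrix_vector_mult_def axis_def if_distrib cong: if_cong)
  hence "sesq S (axis i 1) (axis j 1) = (\<Sum>k\<in>UNIV. if k = i then S $ k $ j else 0)"
    unfolding sesq_def by (intro sum.cong) (auto simp: axis_def)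
  thus ?thesis by simp
qed

text \<open>The real inner product sees only the real part of the form; \<open>sesq\<close> keeps
  the imaginary part, which decides Hermiticity.\<close>

lemma inner_eq_Re_sesq: "inner x (S *v x) = Re (sesq S x x)"
  by (simp add: sesq_def inner_vec_def inner_complex_def)

text \<open>Polarisation: basis vectors give real diagonal entries, and
  \<open>axis i 1 + w *s axis j 1\<close> with \<open>w = 1\<close> and \<open>w = \<i>\<close>
  compares the imaginary and the real parts of \<open>S $ i $ j\<close> and
  \<open>S $ j $ i\<close>.\<close>

lemma hermitian_if_sesq_real:
  assumes "\<And>x. Im (sesq S x x) = 0"
  shows "hermitian_mat S"
proof -
  have "cnj (S $ j $ i) = S $ i $ j" for i j
  proof -
    have e: "Im (S $ k $ k) = 0" for k using assms[of "axis k 1"] by (simp add: sesq_axis)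
    have "Im (w * S $ i $ j + cnj w * S $ j $ i) = 0" if "w = 1 \<or> w = \<i>" for w
      using assms[of "axis i 1 + w *s axis j 1"] e[of i] e[of j] that
      by (auto simp: sesq_add_left sesq_add_right sesq_scale_left sesq_scale_right sesq_axis)
    from this[of 1] this[of \<i>] show ?thesis by (simp add: complex_eq_iff)
  qed
  thus ?thesis by (simp add: hermitian_mat_def vec_eq_iff)
qed

definition rank1_unitary :: "complex \<Rightarrow> complex^'n \<Rightarrow> complex^'n^'n" where
  "rank1_unitary c v = mat 1 + (\<chi> i j. c * v $ i * cnj (v $ j))"

text \<open>With B = c v v\<dagger>, both products of \<open>B\<close> with its adjoint are the same
  multiple of v v\<dagger>, so unitarity follows from one scalar equation. For nonzero
  \<open>v\<close> it says that the eigenvalue \<open>1 + c * (norm v)\<^sup>2\<close> on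
  \<open>v\<close> has modulus 1.\<close>

lemma unitary_rank1:
  assumes "c + cnj c + c * cnj c * of_real ((norm v)\<^sup>2) = 0"
  shows "unitary_mat (rank1_unitary c v)"
proof -
  have n: "(\<Sum>k\<in>UNIV. v $ k * cnj (v $ k)) = of_real ((norm v)\<^sup>2)"
  proof -
    have "(norm v)\<^sup>2 = (\<Sum>k\<in>UNIV. (norm (v $ k))\<^sup>2)"
      by (simp add: norm_vec_def L2_set_def sum_nonneg)
    thus ?thesis by (simp only: of_real_sum complex_norm_square)
  qed
  define B where "B = (\<chi> i j. c * v $ i * cnj (v $ j))"
  have aB: "mat_adj B = (\<chi> i j. cnj c * v $ i * cnj (v $ j))"
    by (simp add: vec_eq_iff B_def mult_ac)
  have BB: "mat_adj B ** B = (\<chi> i j. c * cnj c * of_real ((norm v)\<^sup>2) * v $ i * cnj (v $ j))"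
    "B ** mat_adj B = (\<chi> i j. c * cnj c * of_real ((norm v)\<^sup>2) * v $ i * cnj (v $ j))"
    unfolding aB B_def n[symmetric]
    by (simp_all add: vec_eq_iff matrix_matrix_mult_def sum_distrib_left sum_distrib_right mult_ac)
  have z: "mat_adj B + B + mat_adj B ** B = 0" "mat_adj B + B + B ** mat_adj B = 0"
  proof -
    have "cnj c * v $ i * cnj (v $ j) + c * v $ i * cnj (v $ j)
        + c * cnj c * of_real ((norm v)\<^sup>2) * v $ i * cnj (v $ j)
      = (c + cnj c + c * cnj c * of_real ((norm v)\<^sup>2)) * (v $ i * cnj (v $ j))" for i j
      by (simp only: algebra_simps)
    hence "cnj c * v $ i * cnj (v $ j) + c * v $ i * cnj (v $ j)
        + c * cnj c * of_real ((norm v)\<^sup>2) * v $ i * cnj (v $ j) = 0" for i j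
      by (simp only: assms mult_zero_left)
    thus "mat_adj B + B + mat_adj B ** B = 0" "mat_adj B + B + B ** mat_adj B = 0"
      unfolding BB unfolding aB unfolding B_def by (simp_all add: vec_eq_iff)
  qed
  have "rank1_unitary c v = mat 1 + B" by (simp add: rank1_unitary_def B_def)
  moreover have "mat_adj (mat 1 + B) ** (mat 1 + B) = mat 1 + (mat_adj B + B + mat_adj B ** B)"
    "(mat 1 + B) ** mat_adj (mat 1 + B) = mat 1 + (mat_adj B + B + B ** mat_adj B)"
    by (simp_all add: mat_adj_add mm.add_left mm.add_right)
  ultimately show ?thesis using z by (simp add: unitary_mat_def)
qed

text \<open>Rank-one perturbations of the identity suffice as test directions.\<close>

lemma psd_if_maximal:
  assumes "\<And>R :: complex^'n^'n. unitary_mat R \<Longrightarrow> inner R S \<le> inner (mat 1) S"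
  shows "psd_mat S"
proof -
  have real: "sesq S v v = of_real (cmod (sesq S v v))" for v
  proof (cases "sesq S v v = 0")
    case False
    define q where "q = sesq S v v"
    define z where "z = sgn q"
    have "norm z = 1" using False by (simp add: z_def q_def norm_sgn)
    hence z1: "z * cnj z = 1" by (simp only: complex_norm_square[symmetric]) simp
    have "q = of_real (cmod q) * z"
      using False by (simp add: z_def q_def sgn_div_norm scaleR_conv_of_real)
    hence "cnj z * q = of_real (cmod q) * (z * cnj z)" by (metis mult.assoc mult.commute)
    with z1 have z: "z * cnj z = 1" "cnj z * q = of_real (cmod q)" by simp_all
    have "v \<noteq> 0" using False by (auto simp: sesq_def)
    \<comment> \<open>With this \<open>c\<close> the rank-one unitary multiplies \<open>v\<close> by
      the phase \<open>z\<close> of \<open>q\<close> and fixes the orthogonal complement of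
      \<open>v\<close>.\<close>
    define c where "c = (z - 1) / of_real ((norm v)\<^sup>2)"
    have nv: "(of_real ((norm v)\<^sup>2) :: complex) \<noteq> 0" using \<open>v \<noteq> 0\<close> by simp
    have "c + cnj c + c * cnj c * of_real ((norm v)\<^sup>2)
        = ((z - 1) + (cnj z - 1) + (z - 1) * (cnj z - 1)) / of_real ((norm v)\<^sup>2)"
      using nv by (simp add: c_def field_simps)
    also have "\<dots> = 0" using z(1) by (simp add: algebra_simps)
    finally have "unitary_mat (rank1_unitary c v)" by (rule unitary_rank1)
    from assms[OF this] have "inner (\<chi> i j. c * v $ i * cnj (v $ j)) S \<le> 0"
      by (simp add: rank1_unitary_def inner_add_left)
    also have "inner (\<chi> i j. c * v $ i * cnj (v $ j)) S = Re (cnj c * sesq S v v)"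
      by (simp add: inner_vec_def inner_complex_mult_left sesq_def matrix_vector_mult_def
          sum_distrib_left inner_complex_def algebra_simps)
    also have "cnj c * sesq S v v = (cnj z * q - q) / of_real ((norm v)\<^sup>2)"
      by (simp add: c_def q_def algebra_simps)
    \<comment> \<open>This rotation changes the objective in proportion to
      \<open>cmod q - Re q\<close>. Maximality at the identity forbids an increase, so
      \<open>q\<close> is real and nonnegative.\<close>
    finally have "Re (cnj z * q - q) \<le> 0"
      using \<open>v \<noteq> 0\<close> by (simp add: divide_le_0_iff flip: of_real_power)
    hence "cmod q \<le> Re q" using z(2) by simp
    hence "q = of_real (cmod q)"
      using complex_eq_cancel_iff2 cmod_eq_Re
      by (smt (verit) Complex_eq_0 abs_norm_cancel cmod_power2 complex_eq_iff complex_Re_le_cmod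
          Re_complex_of_real Im_complex_of_real zero_eq_power2)
    thus ?thesis by (simp add: q_def)
  qed simp
  have "Im (sesq S v v) = 0" "0 \<le> Re (sesq S v v)" for v
    by (subst real, simp)+
  thus ?thesis by (simp add: psd_mat_iff_inner hermitian_if_sesq_real inner_eq_Re_sesq)
qed

text \<open>Compactness yields a maximiser \<open>W\<close>. Competing with \<open>W ** R\<close>
  moves the maximum to the identity for \<open>mat_adj W ** X\<close>, where
  \<open>psd_if_maximal\<close> applies.\<close>

lemma polar_exists:
  fixes X :: "complex^'n^'n"
  obtains W where "unitary_mat W" "psd_mat (mat_adj W ** X)"
proof -
  let ?U = "{U :: complex^'n^'n. unitary_mat U}"
  have "mat 1 \<in> ?U" by (simp add: unitary_mat_def)
  hence "\<exists>W\<in>?U. \<forall>V\<in>?U. inner V X \<le> inner W X"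
    by (intro continuous_attains_sup compact_unitary_mat continuous_intros) auto
  then obtain W where W: "unitary_mat W" and max: "\<And>V. unitary_mat V \<Longrightarrow> inner V X \<le> inner W X"
    by auto
  have "psd_mat (mat_adj W ** X)"
  proof (rule psd_if_maximal)
    fix R :: "complex^'n^'n" assume "unitary_mat R"
    hence "inner (W ** R) X \<le> inner (W ** mat 1) X" using max W by (simp add: unitary_mat_mult)
    thus "inner R (mat_adj W ** X) \<le> inner (mat 1) (mat_adj W ** X)"
      by (simp only: inner_matrix_mult)
  qed
  thus ?thesis using W that by blast
qed

section \<open>Uniqueness of the square root and of the polar factors\<close>

lemma psd_sqrt_unique:
  assumes "psd_mat S" "invertible S" "psd_mat T" "T ** T = S ** (S :: complex^'n^'n)"
  shows "T = S"
proof -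
  obtain c where c: "c > 0" "\<And>x. c * (norm x)\<^sup>2 \<le> inner x (S *v x)"
    using psd_invertible_coercive assms by blast
  \<comment> \<open>The mixed products cancel and leave \<open>T ** T - S ** S\<close>.\<close>
  have "S ** (T - S) + (T - S) ** T = 0"
    by (simp add: mm.diff_left mm.diff_right assms(4))
  hence "c * norm (T - S) \<le> 0" using sylvester_norm_le[OF c(2) assms(3), of "T - S"] by simp
  thus ?thesis using c(1) by (simp add: mult_le_0_iff)
qed

lemma mat_sqrt_eqI:
  assumes "psd_mat S" "invertible S" "S ** S = P"
  shows "mat_sqrt P = S"
  unfolding mat_sqrt_def using assms psd_sqrt_unique by (intro the_equality) auto

lemma invertible_mat_adj: "invertible A \<Longrightarrow> invertible (mat_adj A)" for A :: "complex^'n^'n"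
  by (metis invertible_def mat_adj_mult mat_adj_mat_1)

lemma invertible_unitary: "unitary_mat U \<Longrightarrow> invertible U"
  by (auto simp: unitary_mat_def invertible_def)

lemma mat_abs_eqI:
  assumes "unitary_mat W" "psd_mat S" "invertible S" "X = W ** S"
  shows "mat_abs X = S"
  unfolding mat_abs_def
proof (rule mat_sqrt_eqI)
  have "mat_adj X ** X = mat_adj S ** (mat_adj W ** W) ** S"
    by (simp add: assms(4) mat_adj_mult matrix_mul_assoc)
  thus "S ** S = mat_adj X ** X"
    using assms by (simp add: unitary_mat_def psd_mat_def hermitian_mat_def)
qed fact+

definition polar :: "complex^'n^'n \<Rightarrow> complex^'n^'n" where
  "polar X = X ** matrix_inv (mat_abs X)"

lemma matrix_inv:
  assumes "invertible A"
  shows matrix_inv_left: "matrix_inv A ** A = mat 1"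
    and matrix_inv_right: "A ** matrix_inv A = mat 1"
proof -
  have "A ** matrix_inv A = mat 1 \<and> matrix_inv A ** A = mat 1"
    using assms unfolding matrix_inv_def invertible_def by (rule someI_ex)
  thus "matrix_inv A ** A = mat 1" "A ** matrix_inv A = mat 1" by auto
qed

text \<open>For any \<open>W\<close> from \<open>polar_exists\<close>, \<open>mat_adj W ** X\<close>
  is positive and invertible, hence equal to \<open>mat_abs X\<close> by uniqueness of the square
  root; solving for \<open>W\<close> identifies it with \<open>polar X\<close>.\<close>

lemma polar_decomposition:
  fixes X :: "complex^'n^'n"
  assumes "invertible X"
  shows "unitary_mat (polar X)" "psd_mat (mat_abs X)" "invertible (mat_abs X)"
    "polar X ** mat_abs X = X" "mat_adj (polar X) ** X = mat_abs X"
proof -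
  obtain W where W: "unitary_mat W" "psd_mat (mat_adj W ** X)" using polar_exists by blast
  define S where "S = mat_adj W ** X"
  have iS: "invertible S" unfolding S_def
    using W assms invertible_mult invertible_mat_adj invertible_unitary by blast
  have X: "X = W ** S" using W(1) by (simp add: S_def matrix_mul_assoc unitary_mat_def)
  have S: "mat_abs X = S" by (rule mat_abs_eqI[OF W(1) _ iS X]) (simp add: S_def W)
  have "polar X = W ** (S ** matrix_inv S)" by (simp add: polar_def S X[symmetric] matrix_mul_assoc)
  hence p: "polar X = W" by (simp add: matrix_inv_right[OF iS])
  show "unitary_mat (polar X)" "psd_mat (mat_abs X)" "invertible (mat_abs X)"
    "polar X ** mat_abs X = X" "mat_adj (polar X) ** X = mat_abs X"
    unfolding p S
    by (fact W(1), fact W(2)[folded S_def], fact iS, rule X[symmetric], rule S_def[symmetric])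
qed

lemma polar_eqI:
  assumes "unitary_mat W" "psd_mat S" "invertible S" "X = W ** S"
  shows "polar X = W"
proof -
  have "polar X = W ** (S ** matrix_inv S)"
    unfolding polar_def mat_abs_eqI[OF assms] by (simp add: assms(4) matrix_mul_assoc)
  thus ?thesis by (simp add: matrix_inv_right[OF assms(3)])
qed

section \<open>Derivative of the polar factor\<close>

text \<open>The determinant is continuous. Openness allows formulas valid only at invertible
  matrices to be differentiated.\<close>

lemma open_invertible: "open {X :: complex^'n^'n. invertible X}"
proof -
  have "continuous_on UNIV (det :: complex^'n^'n \<Rightarrow> complex)"
    unfolding det_def by (intro continuous_intros)
  thus ?thesis unfolding invertible_det_nz by (intro open_Collect_neq continuous_on_const)
qed

lemma norm_unitary_mult_left:
  assumes "unitary_mat W"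
  shows "norm (W ** M) = norm (M :: complex^'n^'n)"
proof -
  have "mat_adj W ** (W ** M) = M"
    using assms by (simp add: unitary_mat_def matrix_mul_assoc)
  thus ?thesis by (simp add: norm_eq_sqrt_inner inner_matrix_mult)
qed

lemma unitary_mat_adj: "unitary_mat W \<Longrightarrow> unitary_mat (mat_adj W)"
  by (simp add: unitary_mat_def)

lemma norm_unitary_mult_right:
  assumes "unitary_mat W"
  shows "norm (M ** W) = norm (M :: complex^'n^'n)"
  using norm_unitary_mult_left[OF unitary_mat_adj[OF assms], of "mat_adj M"]
  by (simp flip: mat_adj_mult)

lemma sylvester_unique:
  assumes "psd_mat S" "invertible S" "S ** D + D ** S = S ** D' + D' ** (S :: complex^'n^'n)"
  shows "D = D'"
proof -
  obtain c where c: "c > 0" "\<And>x. c * (norm x)\<^sup>2 \<le> inner x (S *v x)"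
    using psd_invertible_coercive assms by blast
  have "S ** (D - D') + (D - D') ** S = 0"
    using assms(3) by (simp add: mm.diff_left mm.diff_right algebra_simps)
  hence "c * norm (D - D') \<le> 0" using sylvester_norm_le[OF c(2) assms(1), of "D - D'"] by simp
  thus ?thesis using c(1) by (simp add: mult_le_0_iff)
qed

text \<open>In finite dimension the injectivity given by \<open>sylvester_unique\<close> implies
  surjectivity.\<close>

lemma sylvester_solvable:
  assumes "psd_mat S" "invertible (S :: complex^'n^'n)"
  obtains D where "S ** D + D ** S = Q"
proof -
  let ?f = "\<lambda>D. S ** D + D ** S"
  have "linear ?f"
    by (rule linearI) (simp_all add: mm.add_left mm.add_right mm.scaleR_left mm.scaleR_right
        algebra_simps)
  moreover have "inj ?f" using sylvester_unique[OF assms] by (intro injI) blast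
  ultimately have "surj ?f" by (rule linear_injective_imp_surjective) (rule refl)
  then obtain D where "Q = ?f D" by (rule surjE)
  thus ?thesis using that by simp
qed

text \<open>Multiplying \<open>Y = polar Y ** mat_abs Y\<close> by \<open>mat_adj (polar X)\<close>
  gives \<open>Z ** mat_abs Y = mat_abs X + E\<close>. Its adjoint, multiplied by \<open>Z\<close>,
  is the first claim; the two together give the second, with no term neglected.\<close>

lemma polar_sylvester:
  fixes X Y :: "complex^'n^'n"
  assumes "invertible X" "invertible Y"
  defines "E \<equiv> mat_adj (polar X) ** (Y - X)" and "Z \<equiv> mat_adj (polar X) ** polar Y"
  shows "mat_abs Y = mat_abs X ** Z + mat_adj E ** Z"
    and "mat_abs X ** (Z - mat 1) + (Z - mat 1) ** mat_abs Y = E - mat_adj E ** Z"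
proof -
  let ?S = "mat_abs X" and ?T = "mat_abs Y" and ?W = "polar X" and ?V = "polar Y"
  note X = polar_decomposition[OF assms(1)] and Y = polar_decomposition[OF assms(2)]
  have uZ: "unitary_mat Z" unfolding Z_def
    using X(1) Y(1) unitary_mat_adj unitary_mat_mult by blast
  have h: "mat_adj ?S = ?S" "mat_adj ?T = ?T"
    using X(2) Y(2) by (auto simp: psd_mat_def hermitian_mat_def)
  have ZT: "Z ** ?T = ?S + E"
    by (simp add: Z_def E_def mm.diff_right X(5) Y(4) flip: matrix_mul_assoc)
  hence "?T ** mat_adj Z = ?S + mat_adj E" by (metis mat_adj_mult mat_adj_add h)
  hence "?T ** (mat_adj Z ** Z) = (?S + mat_adj E) ** Z" by (simp add: matrix_mul_assoc)
  thus T: "?T = ?S ** Z + mat_adj E ** Z"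
    using uZ by (simp add: unitary_mat_def mm.add_left)
  have "?S ** (Z - mat 1) + (Z - mat 1) ** ?T = ?S ** Z - ?S + (Z ** ?T - ?T)"
    by (simp add: mm.diff_left mm.diff_right)
  also have "\<dots> = E + (?S ** Z - ?T)" by (simp add: ZT)
  also have "\<dots> = E - mat_adj E ** Z" by (subst T) simp
  finally show "?S ** (Z - mat 1) + (Z - mat 1) ** ?T = E - mat_adj E ** Z" .
qed

text \<open>\<open>L\<close> solves the linearised Sylvester equation. Subtracting that from the
  exact identity leaves a remainder quadratic in \<open>Y - X\<close>, and coercivity turns it into
  an error bound.\<close>

lemma polar_has_derivative:
  fixes X :: "complex^'n^'n"
  assumes "invertible X"
    and L: "\<And>H. mat_abs X ** L H + L H ** mat_abs X = mat_adj (polar X) ** H - mat_adj H ** polar X"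
  shows "(polar has_derivative (\<lambda>H. polar X ** L H)) (at X)"
proof -
  let ?S = "mat_abs X" and ?W = "polar X"
  note X = polar_decomposition[OF assms(1)]
  obtain c where c: "c > 0" "\<And>x. c * (norm x)\<^sup>2 \<le> inner x (?S *v x)"
    using psd_invertible_coercive X by blast
  obtain K where K: "K > 0" "\<And>(A :: complex^'n^'n) (B :: complex^'n^'n). norm (A ** B) \<le> norm A * norm B * K"
    using mm.pos_bounded by blast
  \<comment> \<open>Linearity follows from uniqueness: both sides of each law solve the same
    Sylvester equation.\<close>
  have lin: "linear L"
  proof (rule linearI; rule sylvester_unique[OF X(2,3)])
    fix r and G H :: "complex^'n^'n"
    have "?S ** (L G + L H) + (L G + L H) ** ?S = (?S ** L G + L G ** ?S) + (?S ** L H + L H ** ?S)"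
      by (simp add: mm.add_left mm.add_right algebra_simps)
    thus "?S ** L (G + H) + L (G + H) ** ?S = ?S ** (L G + L H) + (L G + L H) ** ?S"
      by (simp add: L mm.add_left mm.add_right mat_adj_add)
    have a: "mat_adj (r *\<^sub>R G) = r *\<^sub>R mat_adj G" by (simp add: vec_eq_iff)
    have "?S ** (r *\<^sub>R L G) + (r *\<^sub>R L G) ** ?S = r *\<^sub>R (?S ** L G + L G ** ?S)"
      by (simp add: mm.scaleR_left mm.scaleR_right algebra_simps)
    thus "?S ** L (r *\<^sub>R G) + L (r *\<^sub>R G) ** ?S = ?S ** (r *\<^sub>R L G) + (r *\<^sub>R L G) ** ?S"
      by (simp add: L a mm.scaleR_left mm.scaleR_right scaleR_diff_right)
  qed
  \<comment> \<open>Collects the bound for \<open>norm r\<close> below after inserting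
    \<open>norm D \<le> 2 / c * norm h\<close>; the outer division by \<open>c\<close> comes from
    the second use of coercivity.\<close>
  define C where "C = (K * (2 / c) + K * (2 / c) * (K * norm ?S * (2 / c) + 1)) / c"
  have C: "norm (polar Y - polar X - ?W ** L (Y - X)) \<le> C * (norm (Y - X))\<^sup>2"
    if "invertible Y" for Y
  proof -
    note Y = polar_decomposition[OF that]
    define h where "h = Y - X"
    define E where "E = mat_adj ?W ** h"
    define Z where "Z = mat_adj ?W ** polar Y"
    define D where "D = Z - mat 1"
    note sy = polar_sylvester[OF assms(1) that, folded h_def, folded E_def Z_def, folded D_def]
    have uZ: "unitary_mat Z" unfolding Z_def
      using X(1) Y(1) unitary_mat_adj unitary_mat_mult by blast
    have nE: "norm E = norm h"
      unfolding E_def by (rule norm_unitary_mult_left) (rule unitary_mat_adj[OF X(1)])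
    have nEZ: "norm (mat_adj E ** Z) = norm h"
      by (simp add: norm_unitary_mult_right[OF uZ] nE)
    \<comment> \<open>Unitary factors preserve the norm, so the exact identity makes the polar
      factor Lipschitz at \<open>X\<close>.\<close>
    have "c * norm D \<le> norm (E - mat_adj E ** Z)"
      using sylvester_norm_le[OF c(2) Y(2), of D] sy(2) by simp
    also have "\<dots> \<le> 2 * norm h" using norm_triangle_ineq4[of E "mat_adj E ** Z"] nE nEZ by simp
    finally have nD: "norm D \<le> 2 / c * norm h" using c(1) by (simp add: field_simps)
    \<comment> \<open>The second-order terms left after substituting \<open>Z = mat 1 + D\<close>
      and expanding \<open>mat_abs Y\<close> around \<open>mat_abs X\<close>: each is a product of
      two factors of order \<open>norm h\<close>.\<close>
    define r where "r = mat_adj E ** D + D ** (?S ** D + mat_adj E ** Z)"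
    have Z: "Z = mat 1 + D" by (simp add: D_def)
    have T: "mat_abs Y = ?S + (?S ** D + mat_adj E ** Z)"
      using sy(1) unfolding Z by (simp add: mm.add_right algebra_simps)
    have "?S ** D + D ** ?S = E - mat_adj E ** Z - D ** (?S ** D + mat_adj E ** Z)"
      using sy(2) unfolding T by (simp add: mm.add_right algebra_simps)
    also have "\<dots> = E - mat_adj E - r"
      unfolding r_def by (simp add: Z mm.add_right algebra_simps)
    finally have "?S ** D + D ** ?S = E - mat_adj E - r" .
    moreover have "?S ** (D - L h) + (D - L h) ** ?S
        = (?S ** D + D ** ?S) - (?S ** L h + L h ** ?S)"
      by (simp add: mm.diff_left mm.diff_right)
    moreover have "?S ** L h + L h ** ?S = E - mat_adj E"
      unfolding L E_def by (simp add: mat_adj_mult)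
    ultimately have "?S ** (D - L h) + (D - L h) ** ?S = - r" by simp
    hence "c * norm (D - L h) \<le> norm r"
      using sylvester_norm_le[OF c(2) X(2), of "D - L h"] by simp
    also have "norm r \<le> norm (mat_adj E ** D) + norm (D ** (?S ** D + mat_adj E ** Z))"
      unfolding r_def by (rule norm_triangle_ineq)
    also have "\<dots> \<le> norm h * norm D * K + norm D * (norm ?S * norm D * K + norm h) * K"
    proof (rule add_mono)
      show "norm (mat_adj E ** D) \<le> norm h * norm D * K"
        using K(2)[of "mat_adj E" D] by (simp add: nE)
      have "norm (D ** (?S ** D + mat_adj E ** Z)) \<le> norm D * norm (?S ** D + mat_adj E ** Z) * K"
        by (rule K)
      also have "norm (?S ** D + mat_adj E ** Z) \<le> norm ?S * norm D * K + norm h"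
        using norm_triangle_ineq[of "?S ** D" "mat_adj E ** Z"] K(2)[of ?S D] nEZ by linarith
      finally show "norm (D ** (?S ** D + mat_adj E ** Z))
          \<le> norm D * (norm ?S * norm D * K + norm h) * K"
        using K(1) by (simp add: mult_left_mono mult_right_mono)
    qed
    also have "\<dots> \<le> norm h * (2 / c * norm h) * K
        + (2 / c * norm h) * (norm ?S * (2 / c * norm h) * K + norm h) * K"
      using K(1) c(1) nD by (intro add_mono mult_mono mult_nonneg_nonneg add_nonneg_nonneg) auto
    also have "\<dots> = c * (C * (norm h)\<^sup>2)"
      using c(1) by (simp add: C_def field_simps power2_eq_square)
    finally have "norm (D - L h) \<le> C * (norm h)\<^sup>2" using c(1) by simp
    moreover have "polar Y - polar X - ?W ** L h = ?W ** (D - L h)"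
    proof -
      have "?W ** Z = polar Y"
        using X(1) by (simp add: Z_def matrix_mul_assoc unitary_mat_def)
      thus ?thesis by (simp add: D_def mm.diff_right)
    qed
    ultimately show ?thesis by (simp add: norm_unitary_mult_left[OF X(1)] h_def)
  qed
  obtain e where e: "e > 0" "\<And>Y. dist Y X < e \<Longrightarrow> invertible Y"
    using open_invertible assms(1) unfolding open_dist by (metis mem_Collect_eq)
  show ?thesis
  proof (rule has_derivativeI_sandwich[OF e(1), where H = "\<lambda>Y. C * norm (Y - X)"])
    have "bounded_linear L" using lin by (simp add: linear_conv_bounded_linear)
    thus "bounded_linear (\<lambda>H. ?W ** L H)"
      using bounded_linear_compose[OF mm.bounded_linear_right] by blast
    show "norm (polar Y - polar X - ?W ** L (Y - X)) / norm (Y - X) \<le> C * norm (Y - X)"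
      if "Y \<noteq> X" "dist Y X < e" for Y
      using C[OF e(2)[OF that(2)]] that(1) by (simp add: divide_simps power2_eq_square mult_ac)
    have "((\<lambda>Y. C * norm (Y - X)) \<longlongrightarrow> C * norm (X - X)) (at X)"
      by (intro tendsto_intros)
    thus "((\<lambda>Y. C * norm (Y - X)) \<longlongrightarrow> 0) (at X)" by simp
  qed
qed

section \<open>Gradient and Hessian\<close>

lemma bounded_linear_trace: "bounded_linear (trace :: complex^'n^'n \<Rightarrow> complex)"
  unfolding linear_conv_bounded_linear[symmetric]
  by (rule linearI) (simp_all add: trace_def sum.distrib scaleR_sum_right)

text \<open>The product rule is applied to \<open>trace (mat_adj (polar Y) ** Y)\<close>. The
  derivative of the polar factor does contribute: the trace of its Sylvester equation gives half of
  \<open>trace (mat_adj H ** polar X) - trace (mat_adj polar X ** H)\<close>, which symmetrises the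
  first term.\<close>

lemma trace_norm_has_derivative:
  fixes X :: "complex^'n^'n"
  assumes "invertible X"
  shows "(trace_norm has_derivative
    (\<lambda>H. (trace (mat_adj (polar X) ** H) + trace (mat_adj H ** polar X)) / 2)) (at X)"
proof -
  let ?S = "mat_abs X" and ?W = "polar X"
  note X = polar_decomposition[OF assms]
  have h: "mat_adj ?S = ?S" using X(2) by (auto simp: psd_mat_def hermitian_mat_def)
  have "\<exists>D. ?S ** D + D ** ?S = mat_adj ?W ** H - mat_adj H ** ?W" for H
    using sylvester_solvable[OF X(2,3)] by metis
  then obtain L where L: "\<And>H. ?S ** L H + L H ** ?S = mat_adj ?W ** H - mat_adj H ** ?W"
    by metis
  have "((\<lambda>Y. trace (mat_adj (polar Y) ** Y)) has_derivative
      (\<lambda>H. trace (mat_adj ?W ** H + mat_adj (?W ** L H) ** X))) (at X)"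
    by (intro bounded_linear.has_derivative[OF bounded_linear_trace] mm.FDERIV
        bounded_linear.has_derivative[OF bounded_linear_mat_adj]
        polar_has_derivative assms L has_derivative_ident)
  moreover have "trace (mat_adj ?W ** H + mat_adj (?W ** L H) ** X)
      = (trace (mat_adj ?W ** H) + trace (mat_adj H ** ?W)) / 2" for H
  proof -
    have "mat_adj (L H) ** ?S + ?S ** mat_adj (L H) = mat_adj (?S ** L H + L H ** ?S)"
      by (simp add: mat_adj_add mat_adj_mult h)
    also have "\<dots> = mat_adj H ** ?W - mat_adj ?W ** H"
      unfolding L by (simp add: mat_adj_diff mat_adj_mult)
    finally have "trace (mat_adj (L H) ** ?S) + trace (?S ** mat_adj (L H))
        = trace (mat_adj H ** ?W) - trace (mat_adj ?W ** H)"
      by (metis trace_add trace_sub)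
    hence "2 * trace (mat_adj (L H) ** ?S) = trace (mat_adj H ** ?W) - trace (mat_adj ?W ** H)"
      using trace_mul_sym[of ?S "mat_adj (L H)"] by simp
    moreover have "mat_adj (?W ** L H) ** X = mat_adj (L H) ** ?S"
      by (simp add: mat_adj_mult X(5) flip: matrix_mul_assoc)
    ultimately show ?thesis by (simp add: trace_add field_simps)
  qed
  ultimately have "((\<lambda>Y. trace (mat_adj (polar Y) ** Y)) has_derivative
      (\<lambda>H. (trace (mat_adj ?W ** H) + trace (mat_adj H ** ?W)) / 2)) (at X)" by simp
  thus ?thesis
    by (rule has_derivative_transform_within_open[OF _ open_invertible])
      (simp_all add: assms trace_norm_def polar_decomposition(5))
qed

section \<open>Vectorisation and the commutation matrix\<close>

lemma vec_cols_nth [simp]: "vec_cols X $ p = X $ snd p $ fst p"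
  by (simp add: vec_cols_def)

lemma vec_cols_add: "vec_cols (A + B) = vec_cols A + vec_cols B"
  and vec_cols_diff: "vec_cols (A - B) = vec_cols A - vec_cols B"
  by (simp_all add: vec_eq_iff)

lemma bounded_linear_vec_cols:
  "bounded_linear (vec_cols :: complex^'n^'m \<Rightarrow> complex^('n \<times> 'm))"
  unfolding linear_conv_bounded_linear[symmetric]
  by (rule linearI) (simp_all add: vec_eq_iff)

lemma sum_UNIV_prod: "(\<Sum>p\<in>UNIV. f p) = (\<Sum>a\<in>UNIV. \<Sum>b\<in>UNIV. f (a, b))"
  by (simp add: sum.cartesian_product)

text \<open>Every vector is the vectorisation of a matrix, so \<open>vec_cols_transpose\<close>
  determines the action everywhere.\<close>

lemma commutation_mat_vector_mult: "commutation_mat *v v = (\<chi> p. v $ (snd p, fst p))"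
proof -
  define X where "X = (\<chi> i j. v $ (j, i))"
  have "v = vec_cols X" by (simp add: X_def vec_eq_iff)
  hence "commutation_mat *v v = vec_cols (transpose X)" by (simp add: vec_cols_transpose)
  thus ?thesis by (simp add: vec_eq_iff transpose_def X_def)
qed

lemma commutation_mat_nth:
  "commutation_mat $ p $ q = (if q = (snd p, fst p) then 1 else 0)"
proof -
  have "commutation_mat $ p $ q = (commutation_mat *v axis q 1) $ p"
    by (simp add: matrix_vector_mult_def axis_def if_distrib cong: if_cong)
  thus ?thesis by (auto simp: commutation_mat_vector_mult axis_def)
qed

lemma matrix_mult_commutation_mat: "(E ** commutation_mat) $ i $ p = E $ i $ (snd p, fst p)"
proof -
  have "(E ** commutation_mat) $ i $ p = (\<Sum>q\<in>UNIV. if q = (snd p, fst p) then E $ i $ q else 0)"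
    unfolding matrix_matrix_mult_def commutation_mat_nth vec_lambda_beta
    by (intro sum.cong) (auto simp: prod_eq_iff)
  thus ?thesis by simp
qed

lemma commutation_mat_involution: "commutation_mat ** commutation_mat = mat 1"
  by (simp add: matrix_eq flip: matrix_vector_mul_assoc)
    (simp add: commutation_mat_vector_mult vec_eq_iff)

lemma vec_cols_mat_adj: "vec_cols (mat_adj H) = commutation_mat *v vec_cols (mat_cnj H)"
  unfolding mat_adj_def by (rule vec_cols_transpose)

text \<open>Uniqueness of the Wirtinger derivatives evaluates both definite descriptions.\<close>

lemma deriv_herm_eqI:
  assumes "has_wirtinger_derivs g D E X"
  shows "deriv_herm g X = D + E ** commutation_mat"
proof -
  have "deriv_X g X = D" unfolding deriv_X_def
    using assms has_wirtinger_derivs_unique by (intro the_equality) blast+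
  moreover have "deriv_Xcnj g X = E" unfolding deriv_Xcnj_def
    using assms has_wirtinger_derivs_unique by (intro the_equality) blast+
  ultimately show ?thesis by (simp add: deriv_herm_def)
qed

text \<open>The formula covers non-Hermitian \<open>X\<close> because the Hessian differentiates the
  gradient in all matrix directions.\<close>

lemma grad_herm_trace_norm:
  fixes X :: "complex^'n^'n"
  assumes "invertible X"
  shows "grad_herm trace_norm X
    = (1/2) *\<^sub>R (commutation_mat *v vec_cols (polar X + mat_adj (polar X)))"
proof -
  let ?W = "polar X"
  define D :: "complex^('n \<times> 'n)^1" where "D = (\<chi> i p. cnj (?W $ snd p $ fst p) / 2)"
  define E :: "complex^('n \<times> 'n)^1" where "E = (\<chi> i p. ?W $ snd p $ fst p / 2)"
  have 1: "trace (mat_adj ?W ** H) = (\<Sum>p\<in>UNIV. cnj (?W $ snd p $ fst p) * H $ snd p $ fst p)"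
    for H by (simp add: sum_UNIV_prod trace_def matrix_matrix_mult_def del: UNIV_Times_UNIV)
  have 2: "trace (mat_adj H ** ?W) = (\<Sum>p\<in>UNIV. ?W $ snd p $ fst p * cnj (H $ snd p $ fst p))"
    for H by (simp add: sum_UNIV_prod trace_def matrix_matrix_mult_def mult.commute)
  have "bounded_linear (vec :: complex \<Rightarrow> complex^1)"
    unfolding linear_conv_bounded_linear[symmetric]
    by (rule linearI) (simp_all add: vec_eq_iff)
  from bounded_linear.has_derivative[OF this trace_norm_has_derivative[OF assms]]
  have "has_wirtinger_derivs (\<lambda>Y. vec (trace_norm Y) :: complex^1) D E X"
    unfolding has_wirtinger_derivs_def
    by (rule has_derivative_eq_rhs)
      (simp add: fun_eq_iff vec_eq_iff matrix_vector_mult_def D_def E_def 1 2 mat_cnj_def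
        sum_divide_distrib add_divide_distrib)
  hence "grad_herm trace_norm X $ p = D $ 1 $ p + E $ 1 $ (snd p, fst p)" for p
    by (simp add: grad_herm_def deriv_herm_eqI column_def transpose_def matrix_mult_commutation_mat)
  thus ?thesis
    by (simp add: vec_eq_iff commutation_mat_vector_mult D_def E_def scaleR_conv_of_real[where 'a = complex]
        add_divide_distrib add.commute)
qed

lemma kron_vec_cols:
  fixes A B X :: "complex^'n^'n"
  shows "(transpose B \<otimes>\<^sub>K A) *v vec_cols X = vec_cols (A ** X ** B)"
proof -
  have "(\<Sum>c\<in>UNIV. \<Sum>r\<in>UNIV. B $ c $ j * A $ i $ r * X $ r $ c)
      = (\<Sum>c\<in>UNIV. (\<Sum>r\<in>UNIV. A $ i $ r * X $ r $ c) * B $ c $ j)" for i j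
    by (simp add: sum_distrib_left sum_distrib_right mult_ac)
  thus ?thesis
    by (simp add: vec_eq_iff matrix_vector_mult_def kron_def sum_UNIV_prod transpose_def
        matrix_matrix_mult_def)
qed

text \<open>Identifies \<open>kron_sum S\<close> as the matrix of the Sylvester operator, so that
  \<open>matrix_inv\<close> solves Sylvester equations.\<close>

lemma kron_sum_vec_cols:
  fixes S X :: "complex^'n^'n"
  shows "kron_sum S *v vec_cols X = vec_cols (S ** X + X ** S)"
  using kron_vec_cols[of S "mat 1" X] kron_vec_cols[of "mat 1" S X]
  by (simp add: kron_sum_def matrix_vector_mult_add_rdistrib vec_cols_add add.commute)

lemma scaleR_matrix_vector_mult: "(r *\<^sub>R M) *v v = r *\<^sub>R (M *v (v :: complex^'n))"
  by (simp add: vec_eq_iff matrix_vector_mult_def scaleR_sum_right)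

text \<open>The derivative of \<open>polar Y + mat_adj (polar Y)\<close> at \<open>A\<close> depends
  on \<open>H\<close> only through \<open>H + mat_adj H\<close>. Hence both Wirtinger parts
  contribute equally, which cancels the factor one half of the gradient.\<close>

lemma hessian_herm_trace_norm:
  fixes A :: "complex^'n^'n"
  assumes A: "invertible A" and W: "mat_adj (polar A) = polar A"
    and comm: "mat_abs A ** polar A = polar A ** mat_abs A"
    and inv: "invertible (kron_sum (mat_abs A))"
  shows "grad_herm trace_norm differentiable (at A)"
    and "hessian_herm trace_norm A = commutation_mat **
      (matrix_inv (kron_sum (mat_abs A)) ** (mat 1 - transpose (polar A) \<otimes>\<^sub>K polar A))"
proof -
  let ?S = "mat_abs A" and ?W = "polar A"
  let ?K = "commutation_mat :: complex^('n \<times> 'n)^('n \<times> 'n)"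
  note X = polar_decomposition[OF assms(1)]
  define N where "N = matrix_inv (kron_sum ?S) ** (mat 1 - transpose ?W \<otimes>\<^sub>K ?W)"
  have h: "mat_adj ?S = ?S" using X(2) by (auto simp: psd_mat_def hermitian_mat_def)
  have WW: "?W ** ?W = mat 1" using X(1) W by (simp add: unitary_mat_def)
  have "\<exists>D. ?S ** D + D ** ?S = mat_adj ?W ** H - mat_adj H ** ?W" for H
    using sylvester_solvable[OF X(2,3)] by metis
  then obtain L where L: "\<And>H. ?S ** L H + L H ** ?S = mat_adj ?W ** H - mat_adj H ** ?W"
    by metis
  have Q: "vec_cols (?W ** L H + mat_adj (?W ** L H))
      = N *v (vec_cols H + ?K *v vec_cols (mat_cnj H))" for H
  proof -
    define Q where "Q = ?W ** L H"
    \<comment> \<open>Multiplying the equation for \<open>L H\<close> by \<open>?W\<close> from the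
      left, which commutes with \<open>?S\<close>, and using that \<open>?W\<close> is a Hermitian
      involution.\<close>
    have SQ: "?S ** Q + Q ** ?S = H - ?W ** mat_adj H ** ?W"
    proof -
      have "?S ** Q + Q ** ?S = ?W ** (?S ** L H + L H ** ?S)"
        by (simp add: Q_def mm.add_right matrix_mul_assoc comm)
      thus ?thesis
        unfolding L W by (simp add: mm.diff_right matrix_mul_assoc WW)
    qed
    have "?S ** mat_adj Q + mat_adj Q ** ?S = mat_adj (?S ** Q + Q ** ?S)"
      by (simp add: mat_adj_add mat_adj_mult h add.commute)
    also have "\<dots> = mat_adj H - ?W ** H ** ?W"
      unfolding SQ by (simp add: mat_adj_diff mat_adj_mult W matrix_mul_assoc)
    finally have SQ': "?S ** mat_adj Q + mat_adj Q ** ?S = mat_adj H - ?W ** H ** ?W" .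
    have "?S ** (Q + mat_adj Q) + (Q + mat_adj Q) ** ?S
        = (?S ** Q + Q ** ?S) + (?S ** mat_adj Q + mat_adj Q ** ?S)"
      by (simp add: mm.add_left mm.add_right)
    also have "\<dots> = (H + mat_adj H) - ?W ** (H + mat_adj H) ** ?W"
      unfolding SQ SQ' by (simp add: mm.add_left mm.add_right)
    finally have "?S ** (Q + mat_adj Q) + (Q + mat_adj Q) ** ?S
        = (H + mat_adj H) - ?W ** (H + mat_adj H) ** ?W" .
    hence "kron_sum ?S *v vec_cols (Q + mat_adj Q)
        = vec_cols (H + mat_adj H) - vec_cols (?W ** (H + mat_adj H) ** ?W)"
      by (simp add: kron_sum_vec_cols vec_cols_diff)
    also have "\<dots> = (mat 1 - transpose ?W \<otimes>\<^sub>K ?W) *v vec_cols (H + mat_adj H)"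
      by (simp add: matrix_vector_mult_diff_rdistrib kron_vec_cols)
    finally have "(matrix_inv (kron_sum ?S) ** kron_sum ?S) *v vec_cols (Q + mat_adj Q)
        = N *v vec_cols (H + mat_adj H)"
      by (simp add: N_def flip: matrix_vector_mul_assoc)
    thus ?thesis
      by (simp add: matrix_inv_left[OF inv] vec_cols_add vec_cols_mat_adj Q_def)
  qed
  define D where "D = (1/2) *\<^sub>R (?K ** N)"
  define E where "E = (1/2) *\<^sub>R (?K ** N ** ?K)"
  let ?g = "\<lambda>Y :: complex^'n^'n. (1/2) *\<^sub>R (?K *v vec_cols (polar Y + mat_adj (polar Y)))"
  have "(?g has_derivative (\<lambda>H. (1/2) *\<^sub>R (?K *v vec_cols (?W ** L H + mat_adj (?W ** L H))))) (at A)"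
    by (intro has_derivative_scaleR_right has_derivative_add
        bounded_linear.has_derivative[OF matrix_vector_mul_bounded_linear]
        bounded_linear.has_derivative[OF bounded_linear_vec_cols]
        bounded_linear.has_derivative[OF bounded_linear_mat_adj]
        polar_has_derivative A L)
  hence "(?g has_derivative (\<lambda>H. D *v vec_cols H + E *v vec_cols (mat_cnj H))) (at A)"
    unfolding Q
    by (rule has_derivative_eq_rhs)
      (simp add: D_def E_def fun_eq_iff scaleR_matrix_vector_mult scaleR_add_right
        matrix_vector_right_distrib matrix_vector_mul_assoc matrix_mul_assoc)
  hence d: "(grad_herm trace_norm has_derivative
      (\<lambda>H. D *v vec_cols H + E *v vec_cols (mat_cnj H))) (at A)"
    by (rule has_derivative_transform_within_open[OF _ open_invertible])
      (simp_all add: A grad_herm_trace_norm)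
  thus "grad_herm trace_norm differentiable (at A)" by (rule differentiableI)
  have "hessian_herm trace_norm A = D + E ** ?K"
    unfolding hessian_herm_def using d by (intro deriv_herm_eqI) (simp add: has_wirtinger_derivs_def)
  \<comment> \<open>\<open>E\<close> carries an extra \<open>?K\<close> from the vectorised adjoint,
    and the commutation matrix is an involution.\<close>
  also have "E ** ?K = D"
    by (simp add: D_def E_def mm.scaleR_left commutation_mat_involution flip: matrix_mul_assoc)
  also have "D + D = ?K ** N" unfolding D_def by (simp flip: scaleR_add_left)
  finally show "hessian_herm trace_norm A = ?K ** (matrix_inv (kron_sum ?S) **
      (mat 1 - transpose ?W \<otimes>\<^sub>K ?W))" by (simp add: N_def)
qed

section \<open>Simultaneously diagonalised matrices\<close>

definition diag :: "('n \<Rightarrow> complex) \<Rightarrow> complex^'n^'n" where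
  "diag d = (\<chi> i j. if i = j then d i else 0)"

text \<open>For a fixed unitary frame \<open>U\<close>, sums, products and inverses become pointwise
  operations on \<open>d\<close>.\<close>

definition unitary_diag :: "complex^'n^'n \<Rightarrow> ('n \<Rightarrow> complex) \<Rightarrow> complex^'n^'n" where
  "unitary_diag U d = U ** diag d ** mat_adj U"

lemma diag_1: "diag (\<lambda>_. 1) = mat 1"
  by (simp add: diag_def mat_def)

lemma diag_mult: "diag d ** diag e = diag (\<lambda>i. d i * e i)"
proof -
  have "(\<Sum>k\<in>UNIV. (if i = k then d i else 0) * (if k = j then e k else 0))
      = (\<Sum>k\<in>UNIV. if k = i then (if i = j then d i * e i else 0) else 0)" for i j
    by (intro sum.cong) auto
  thus ?thesis by (simp add: diag_def matrix_matrix_mult_def vec_eq_iff)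
qed

lemma diag_diff: "diag d - diag e = diag (\<lambda>i. d i - e i)"
  by (simp add: diag_def vec_eq_iff)

lemma diag_add: "diag d + diag e = diag (\<lambda>i. d i + e i)"
  by (simp add: diag_def vec_eq_iff)

lemma transpose_diag: "transpose (diag d) = diag d"
  by (simp add: diag_def transpose_def vec_eq_iff)

lemma kron_diag: "diag d \<otimes>\<^sub>K diag e = diag (\<lambda>p. d (fst p) * e (snd p))"
  by (simp add: diag_def kron_def vec_eq_iff)

lemma kron_sum_diag: "kron_sum (diag d) = diag (\<lambda>p. d (fst p) + d (snd p))"
  by (simp add: kron_sum_def transpose_diag kron_diag diag_add flip: diag_1)

lemma unitary_diag_mat_1: "unitary_diag (mat 1) d = diag d"
  by (simp add: unitary_diag_def)

lemma unitary_diag_1: "unitary_mat U \<Longrightarrow> unitary_diag U (\<lambda>_. 1) = mat 1"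
  by (simp add: unitary_diag_def diag_1 unitary_mat_def)

lemma unitary_diag_mult:
  assumes "unitary_mat U"
  shows "unitary_diag U d ** unitary_diag U e = unitary_diag U (\<lambda>i. d i * e i)"
proof -
  have "unitary_diag U d ** unitary_diag U e = U ** diag d ** (mat_adj U ** U) ** diag e ** mat_adj U"
    by (simp add: unitary_diag_def matrix_mul_assoc)
  also have "\<dots> = U ** (diag d ** diag e) ** mat_adj U"
    using assms by (simp add: unitary_mat_def matrix_mul_assoc)
  finally show ?thesis by (simp add: unitary_diag_def diag_mult)
qed

lemma unitary_diag_add: "unitary_diag U d + unitary_diag U e = unitary_diag U (\<lambda>i. d i + e i)"
  and unitary_diag_diff: "unitary_diag U d - unitary_diag U e = unitary_diag U (\<lambda>i. d i - e i)"
  by (simp_all add: unitary_diag_def mm.add_left mm.add_right mm.diff_left mm.diff_right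
      flip: diag_add diag_diff)

lemma unitary_diag_scaleR: "r *\<^sub>R unitary_diag U d = unitary_diag U (\<lambda>i. of_real r * d i)"
proof -
  have "diag (\<lambda>i. of_real r * d i) = r *\<^sub>R diag d"
    by (simp add: diag_def vec_eq_iff scaleR_conv_of_real[where 'a = complex])
  thus ?thesis by (simp add: unitary_diag_def mm.scaleR_left mm.scaleR_right)
qed

lemma mat_adj_unitary_diag: "mat_adj (unitary_diag U d) = unitary_diag U (\<lambda>i. cnj (d i))"
proof -
  have "mat_adj (diag d) = diag (\<lambda>i. cnj (d i))" by (auto simp: diag_def vec_eq_iff)
  thus ?thesis by (simp add: unitary_diag_def mat_adj_mult matrix_mul_assoc)
qed

lemma matrix_inv_eqI:
  assumes "A ** B = mat 1" "B ** A = mat 1"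
  shows "matrix_inv A = B"
proof -
  have "invertible A" using assms invertible_def by blast
  hence "matrix_inv A ** (A ** B) = B" by (simp add: matrix_mul_assoc matrix_inv_left)
  thus ?thesis by (simp add: assms(1))
qed

lemma unitary_diag_inverse:
  assumes U: "unitary_mat U" and "\<And>i. d i \<noteq> 0"
  shows invertible_unitary_diag: "invertible (unitary_diag U d)"
    and matrix_inv_unitary_diag: "matrix_inv (unitary_diag U d) = unitary_diag U (\<lambda>i. 1 / d i)"
proof -
  have "unitary_diag U d ** unitary_diag U (\<lambda>i. 1 / d i) = mat 1"
    "unitary_diag U (\<lambda>i. 1 / d i) ** unitary_diag U d = mat 1"
    using assms by (simp_all add: unitary_diag_mult unitary_diag_1)
  thus "invertible (unitary_diag U d)"
    "matrix_inv (unitary_diag U d) = unitary_diag U (\<lambda>i. 1 / d i)"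
    using matrix_inv_eqI invertible_def by blast+
qed

text \<open>In the coordinates \<open>mat_adj U *v x\<close> the quadratic form is a sum of squared
  moduli weighted by \<open>d\<close>.\<close>

lemma psd_unitary_diag:
  assumes "\<And>i. d i \<ge> 0"
  shows "psd_mat (unitary_diag U (\<lambda>i. complex_of_real (d i)))"
  unfolding psd_mat_iff_inner
proof (intro conjI allI)
  show "hermitian_mat (unitary_diag U (\<lambda>i. complex_of_real (d i)))"
    by (simp add: hermitian_mat_def mat_adj_unitary_diag)
  fix x
  define y where "y = mat_adj U *v x"
  have "inner x (unitary_diag U (\<lambda>i. complex_of_real (d i)) *v x)
      = inner (mat_adj U *v x) (diag (\<lambda>i. complex_of_real (d i)) *v (mat_adj U *v x))"
    unfolding unitary_diag_def inner_matrix_vector_mult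
    by (simp add: matrix_vector_mul_assoc matrix_mul_assoc)
  also have "\<dots> = (\<Sum>i\<in>UNIV. d i * (norm (y $ i))\<^sup>2)"
  proof -
    have "(diag (\<lambda>i. complex_of_real (d i)) *v y) $ i = d i *\<^sub>R y $ i" for i
    proof -
      have "(diag (\<lambda>i. complex_of_real (d i)) *v y) $ i
          = (\<Sum>j\<in>UNIV. if j = i then d i *\<^sub>R y $ i else 0)"
        unfolding diag_def matrix_vector_mult_def vec_lambda_beta
        by (intro sum.cong) (auto simp: scaleR_conv_of_real)
      thus ?thesis by simp
    qed
    thus ?thesis unfolding y_def[symmetric] by (simp add: inner_vec_def power2_norm_eq_inner)
  qed
  also have "\<dots> \<ge> 0" using assms by (intro sum_nonneg) simp
  finally show "0 \<le> inner x (unitary_diag U (\<lambda>i. complex_of_real (d i)) *v x)" .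
qed

section \<open>Kronecker products in a unitary eigenframe\<close>

lemma kron_mult: "(A \<otimes>\<^sub>K B) ** (C \<otimes>\<^sub>K D) = (A ** C) \<otimes>\<^sub>K (B ** D)"
  by (simp add: vec_eq_iff kron_def matrix_matrix_mult_def sum_UNIV_prod sum_product mult_ac)

lemma mat_adj_kron_unitary: "mat_adj (mat_cnj U \<otimes>\<^sub>K U) = transpose U \<otimes>\<^sub>K mat_adj U"
  by (simp add: vec_eq_iff kron_def mat_cnj_def transpose_def)

lemma unitary_mat_cnj: "unitary_mat U \<Longrightarrow> mat_cnj U ** transpose U = mat 1 \<and> transpose U ** mat_cnj U = mat 1"
  unfolding unitary_mat_def mat_adj_def
  by (metis matrix_transpose_mul transpose_mat transpose_transpose)

lemma kron_mat_1: "mat 1 \<otimes>\<^sub>K mat 1 = mat 1"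
  using kron_diag[of "\<lambda>_. 1" "\<lambda>_. 1"] by (simp add: diag_1)

lemma unitary_kron:
  assumes "unitary_mat U"
  shows "unitary_mat (mat_cnj U \<otimes>\<^sub>K U)"
  using assms unitary_mat_cnj[OF assms]
  unfolding unitary_mat_def mat_adj_kron_unitary by (simp add: kron_mult kron_mat_1)

text \<open>Transposition replaces the frame \<open>U\<close> by its conjugate; the mixed product
  rule then factors the Kronecker product.\<close>

lemma kron_unitary_diag:
  "transpose (unitary_diag U d) \<otimes>\<^sub>K unitary_diag U e
    = unitary_diag (mat_cnj U \<otimes>\<^sub>K U) (\<lambda>p. d (fst p) * e (snd p))"
proof -
  have "transpose (unitary_diag U d) = mat_cnj U ** diag d ** transpose U"
    by (simp add: unitary_diag_def matrix_transpose_mul transpose_diag mat_adj_def matrix_mul_assoc)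
  thus ?thesis
    unfolding unitary_diag_def mat_adj_kron_unitary kron_diag[symmetric]
    by (simp add: kron_mult)
qed

lemma kron_sum_unitary_diag:
  assumes "unitary_mat U"
  shows "kron_sum (unitary_diag U d)
    = unitary_diag (mat_cnj U \<otimes>\<^sub>K U) (\<lambda>p. d (fst p) + d (snd p))"
  using kron_unitary_diag[of U d "\<lambda>_. 1"] kron_unitary_diag[of U "\<lambda>_. 1" d]
  by (simp add: kron_sum_def unitary_diag_1[OF assms] unitary_diag_add)

text \<open>Writing each real eigenvalue as sign times modulus gives a polar decomposition, and the
  factors are unique.\<close>

lemma polar_unitary_diag:
  assumes U: "unitary_mat U" and l: "\<And>i. l i \<noteq> (0 :: real)"
  shows "polar (unitary_diag U (\<lambda>i. of_real (l i))) = unitary_diag U (\<lambda>i. of_real (sgn (l i)))" (is ?P)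
    and "mat_abs (unitary_diag U (\<lambda>i. of_real (l i))) = unitary_diag U (\<lambda>i. of_real \<bar>l i\<bar>)" (is ?A)
proof -
  let ?W = "unitary_diag U (\<lambda>i. of_real (sgn (l i)))"
  let ?S = "unitary_diag U (\<lambda>i. of_real \<bar>l i\<bar>)"
  have "sgn (l i) * sgn (l i) = 1" for i using l by (simp add: sgn_if)
  hence 1: "unitary_mat ?W"
    by (simp add: unitary_mat_def mat_adj_unitary_diag unitary_diag_mult[OF U] unitary_diag_1[OF U]
        flip: of_real_mult)
  have 2: "psd_mat ?S" by (rule psd_unitary_diag) simp
  have 3: "invertible ?S" using l by (intro invertible_unitary_diag U) simp
  have 4: "unitary_diag U (\<lambda>i. of_real (l i)) = ?W ** ?S"
    by (simp add: unitary_diag_mult[OF U] sgn_mult_abs flip: of_real_mult)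
  show ?P ?A using polar_eqI[OF 1 2 3 4] mat_abs_eqI[OF 1 2 3 4] by simp_all
qed

text \<open>The first Hessian formula evaluated on a pair of eigenvalues of \<open>A\<close>,
  reduced to the weight in the second.\<close>

lemma half_kron_sum_weight:
  fixes x y :: real
  assumes "x \<noteq> 0" "y \<noteq> 0"
  shows "1/2 * (1 / \<bar>x\<bar> + 1 / \<bar>y\<bar> - (x + y) * (1 / (\<bar>x\<bar> + \<bar>y\<bar>)) * (1 / \<bar>x\<bar> + 1 / \<bar>y\<bar>)
    * (1 / (\<bar>x\<bar> + \<bar>y\<bar>)) * (x + y)) = (1 - sgn x * sgn y) / (\<bar>x\<bar> + \<bar>y\<bar>)"
proof -
  define a b s t u where "a = \<bar>x\<bar>" "b = \<bar>y\<bar>" "s = sgn x" "t = sgn y" and u: "u = 1 - s * t"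
  note d = \<open>a = \<bar>x\<bar>\<close> \<open>b = \<bar>y\<bar>\<close> \<open>s = sgn x\<close> \<open>t = sgn y\<close>
  have xy: "x = s * a" "y = t * b" by (simp_all add: d sgn_mult_abs)
  have st: "s * s = 1" "t * t = 1" using assms by (simp_all add: d sgn_if)
  have ab: "a > 0" "b > 0" using assms by (simp_all add: d)
  \<comment> \<open>Since the signs square to 1, only the cross terms \<open>2 * a * b\<close> and
    \<open>2 * s * t * a * b\<close> survive.\<close>
  have q: "(a + b)\<^sup>2 - (x + y)\<^sup>2 = 2 * (a * b * u)"
    using st unfolding xy u by algebra
  have "1/2 * (1 / a + 1 / b - (x + y) * (1 / (a + b)) * (1 / a + 1 / b) * (1 / (a + b)) * (x + y))
    = (1/a + 1/b) * ((a + b)\<^sup>2 - (x + y)\<^sup>2) / (2 * (a + b)\<^sup>2)"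
    using ab by (simp add: divide_simps power2_eq_square) (simp add: algebra_simps)
  also have "\<dots> = (1/a + 1/b) * (a * b) * u / (a + b)\<^sup>2"
    unfolding q by simp
  also have "(1/a + 1/b) * (a * b) = a + b" using ab by (simp add: field_simps)
  also have "(a + b) * u / (a + b)\<^sup>2 = u / (a + b)"
    using ab by (simp add: power2_eq_square)
  finally show ?thesis by (simp only: u d)
qed

text \<open>The differentiability clauses ensure that the definite descriptions behind the Hessian
  denote genuine derivatives.\<close>

theorem mainTheorem4:
  fixes A U L :: "complex^'n^'n"
  assumes "invertible A"
    and "hermitian_mat A"
    and "unitary_mat U"
    and "real_diagonal_mat L"
    and "A = U ** L ** mat_adj U"
  shows "(\<forall>X :: complex^'n^'n. invertible X \<longrightarrow> trace_norm differentiable (at X))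
    \<and> grad_herm trace_norm differentiable (at A)
    \<and> hessian_herm trace_norm A =
        (1/2) *\<^sub>R (commutation_mat **
          (kron_sum (matrix_inv (mat_abs A))
            - kron_sum A ** matrix_inv (kron_sum (mat_abs A))
                ** kron_sum (matrix_inv (mat_abs A))
                ** matrix_inv (kron_sum (mat_abs A)) ** kron_sum A))
    \<and> hessian_herm trace_norm A =
        commutation_mat ** (mat_cnj U \<otimes>\<^sub>K U)
          ** (mat 1 - sign_mat L \<otimes>\<^sub>K sign_mat L)
          ** matrix_inv (kron_sum (mat_abs L))
          ** (transpose U \<otimes>\<^sub>K mat_adj U)"
proof -
  note U = assms(3)
  define V where "V = mat_cnj U \<otimes>\<^sub>K U"
  have V: "unitary_mat V" unfolding V_def by (rule unitary_kron[OF U])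
  define l where "l = (\<lambda>i. Re (L $ i $ i))"
  have L: "L = diag (\<lambda>i. of_real (l i))"
    using assms(4) by (simp add: real_diagonal_mat_def diag_def l_def vec_eq_iff)
  hence A: "A = unitary_diag U (\<lambda>i. of_real (l i))" using assms(5) by (simp add: unitary_diag_def)
  \<comment> \<open>A zero diagonal entry would make a whole row of \<open>L\<close> vanish,
    contradicting its invertibility.\<close>
  have l: "l i \<noteq> 0" for i
  proof
    assume "l i = 0"
    have "L = mat_adj U ** A ** U"
    proof -
      have "mat_adj U ** A ** U = (mat_adj U ** U) ** L ** (mat_adj U ** U)"
        by (simp add: assms(5) matrix_mul_assoc)
      thus ?thesis using U by (simp add: unitary_mat_def)
    qed
    hence "invertible L"
      using assms(1) U by (simp add: invertible_mult invertible_mat_adj invertible_unitary)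
    hence "(L ** matrix_inv L) $ i $ i = 1" by (simp add: matrix_inv_right mat_def)
    moreover have "(L ** matrix_inv L) $ i $ i = 0"
      using \<open>l i = 0\<close> unfolding L matrix_matrix_mult_def diag_def vec_lambda_beta
      by (intro sum.neutral) simp
    ultimately show False by simp
  qed
  have W: "polar A = unitary_diag U (\<lambda>i. of_real (sgn (l i)))"
    and S: "mat_abs A = unitary_diag U (\<lambda>i. of_real \<bar>l i\<bar>)"
    unfolding A by (rule polar_unitary_diag[OF U l])+
  have "unitary_mat (mat 1 :: complex^'n^'n)" by (simp add: unitary_mat_def)
  hence SL: "mat_abs L = diag (\<lambda>i. of_real \<bar>l i\<bar>)"
    using polar_unitary_diag(2)[of "mat 1" l] l by (simp add: L unitary_diag_mat_1)
  have sL: "sign_mat L = diag (\<lambda>i. of_real (sgn (l i)))"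
    by (simp add: L sign_mat_def diag_def vec_eq_iff sgn_of_real)
  have pos: "complex_of_real \<bar>l i\<bar> + of_real \<bar>l j\<bar> \<noteq> 0" for i j
    using l[of i] l[of j] by (simp flip: of_real_add)
  \<comment> \<open>The common diagonal weight: the Hessian and both formulas are shown to equal
    \<open>commutation_mat ** unitary_diag V f\<close>.\<close>
  define f where "f = (\<lambda>p. (1 - complex_of_real (sgn (l (fst p))) * of_real (sgn (l (snd p))))
    / (of_real \<bar>l (fst p)\<bar> + of_real \<bar>l (snd p)\<bar>))"
  have kS: "kron_sum (mat_abs A)
      = unitary_diag V (\<lambda>p. of_real \<bar>l (fst p)\<bar> + of_real \<bar>l (snd p)\<bar>)"
    unfolding S V_def by (rule kron_sum_unitary_diag[OF U])
  have ikS: "invertible (kron_sum (mat_abs A))"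
    "matrix_inv (kron_sum (mat_abs A))
      = unitary_diag V (\<lambda>p. 1 / (of_real \<bar>l (fst p)\<bar> + of_real \<bar>l (snd p)\<bar>))"
    unfolding kS by (intro invertible_unitary_diag matrix_inv_unitary_diag V pos)+
  note hess = hessian_herm_trace_norm[OF assms(1) _ _ ikS(1)]
  have W1: "mat_adj (polar A) = polar A" by (simp add: W mat_adj_unitary_diag)
  have W2: "mat_abs A ** polar A = polar A ** mat_abs A"
    by (simp add: W S unitary_diag_mult[OF U] mult.commute)
  have "matrix_inv (kron_sum (mat_abs A)) ** (mat 1 - transpose (polar A) \<otimes>\<^sub>K polar A)
      = unitary_diag V f"
    unfolding ikS W kron_unitary_diag V_def[symmetric] unitary_diag_1[OF V, symmetric]
      unitary_diag_diff unitary_diag_mult[OF V] f_def by simp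
  hence H: "hessian_herm trace_norm A = commutation_mat ** unitary_diag V f"
    using hess(2)[OF W1 W2] by simp
  have iS: "matrix_inv (mat_abs A) = unitary_diag U (\<lambda>i. 1 / of_real \<bar>l i\<bar>)"
    unfolding S using l by (intro matrix_inv_unitary_diag U) simp
  have "(1/2) *\<^sub>R (kron_sum (matrix_inv (mat_abs A))
            - kron_sum A ** matrix_inv (kron_sum (mat_abs A))
                ** kron_sum (matrix_inv (mat_abs A))
                ** matrix_inv (kron_sum (mat_abs A)) ** kron_sum A) = unitary_diag V f"
  proof -
    \<comment> \<open>The real identity transported to the complex numbers, in the exact shape
      produced by the pointwise rules.\<close>
    have weight: "of_real (1/2) * (1 / of_real \<bar>x\<bar> + 1 / of_real \<bar>y\<bar>
        - (of_real x + of_real y) * (1 / (of_real \<bar>x\<bar> + of_real \<bar>y\<bar>))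
          * (1 / of_real \<bar>x\<bar> + 1 / of_real \<bar>y\<bar>)
          * (1 / (of_real \<bar>x\<bar> + of_real \<bar>y\<bar>)) * (of_real x + of_real y))
      = (1 - complex_of_real (sgn x) * of_real (sgn y)) / (of_real \<bar>x\<bar> + of_real \<bar>y\<bar>)"
      if "x \<noteq> 0" "y \<noteq> 0" for x y :: real
    proof -
      from half_kron_sum_weight[OF that, THEN arg_cong[where f = complex_of_real]]
      show ?thesis by (simp only: of_real_add of_real_mult of_real_diff of_real_divide
            of_real_1 of_real_numeral)
    qed
    show ?thesis
      unfolding ikS iS
      unfolding A kron_sum_unitary_diag[OF U] V_def[symmetric] unitary_diag_mult[OF V]
        unitary_diag_diff unitary_diag_scaleR f_def
      by (simp only: weight[OF l l])
  qed
  hence F1: "(1/2) *\<^sub>R (commutation_mat ** (kron_sum (matrix_inv (mat_abs A))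
            - kron_sum A ** matrix_inv (kron_sum (mat_abs A))
                ** kron_sum (matrix_inv (mat_abs A))
                ** matrix_inv (kron_sum (mat_abs A)) ** kron_sum A))
      = commutation_mat ** unitary_diag V f"
    by (simp flip: mm.scaleR_right)
  have "(mat 1 - sign_mat L \<otimes>\<^sub>K sign_mat L) ** matrix_inv (kron_sum (mat_abs L)) = diag f"
  proof -
    have "matrix_inv (kron_sum (mat_abs L))
        = diag (\<lambda>p. 1 / (of_real \<bar>l (fst p)\<bar> + of_real \<bar>l (snd p)\<bar>))"
      using matrix_inv_unitary_diag[of "mat 1" "\<lambda>p. of_real \<bar>l (fst p)\<bar> + of_real \<bar>l (snd p)\<bar>"] pos
      by (simp add: SL kron_sum_diag unitary_diag_mat_1 unitary_mat_def)
    thus ?thesis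
      by (simp add: sL kron_diag diag_diff diag_mult f_def flip: diag_1)
  qed
  hence "(mat_cnj U \<otimes>\<^sub>K U) ** (mat 1 - sign_mat L \<otimes>\<^sub>K sign_mat L)
          ** matrix_inv (kron_sum (mat_abs L)) ** (transpose U \<otimes>\<^sub>K mat_adj U) = unitary_diag V f"
    by (simp add: unitary_diag_def V_def mat_adj_kron_unitary flip: matrix_mul_assoc)
  hence F2: "commutation_mat ** (mat_cnj U \<otimes>\<^sub>K U) ** (mat 1 - sign_mat L \<otimes>\<^sub>K sign_mat L)
          ** matrix_inv (kron_sum (mat_abs L)) ** (transpose U \<otimes>\<^sub>K mat_adj U)
      = commutation_mat ** unitary_diag V f"
    by (simp only: flip: matrix_mul_assoc)
  show ?thesis
    unfolding H F1 F2 using hess(1)[OF W1 W2] trace_norm_has_derivative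
    by (blast intro: differentiableI)
qed

end
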